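(* Let $(X_k)_{k\ge 1}$ be a sequence of real-valued random variables on a probability space $(\Omega,\mathcal{K},P_X)$, and let $Y$ be a real-valued random variable such that, for some constant $M>0$, $$\frac1n\sum_{k=1}^n P(|X_k|>x)\le M\,P(|Y|>x)\quad\text{for all } x>0 \text{ and all integers } n\ge 1.$$ Let $1\le p<2$ and suppose $E|Y|^p<\infty$. (i) If $1\le r<p$, then for every $\varepsilon>0$ $$\sum_{n=1}^\infty n^{p/r-2}\, P_X\left(\max_{1\le k\le n} k^{r/2}\, E_{\tilde\theta_k}|S_k(\tilde\theta_k)|^r>\varepsilon n\right)<\infty.$$ (ii) If in addition $E\left[|Y|^p\log^+|Y|\right]<\infty$, then the same statement holds for $r=p$, i.e. for every $\varepsilon>0$ $$\sum_{n=1}^\infty n^{-1}\, P_X\left(\max_{1\le k\le n} k^{p/2}\, E_{\tilde\theta_k}|S_k(\tilde\theta_k)|^p>\varepsilon n\right)<\infty.$$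
   Context: For each integer $k\ge 1$, $\tilde\theta_k=(\theta_{k,1},\dots,\theta_{k,k})$ is a random vector distributed uniformly on the unit sphere $\mathbb{S}^{k-1}\subset\mathbb{R}^k$ (i.e. according to the unique rotationally invariant probability measure $P_{\tilde\theta_k}$ on $\mathbb{S}^{k-1}$; for $k=1$ this is the uniform distribution on $\{-1,1\}$), independent of $(X_1,\dots,X_k)$, and $S_k(\tilde\theta_k)=\theta_{k,1}X_1+\cdots+\theta_{k,k}X_k$. The symbol $E_{\tilde\theta_k}$ denotes expectation with respect to $P_{\tilde\theta_k}$ only, so that for $s>0$, $E_{\tilde\theta_k}|S_k(\tilde\theta_k)|^s$ is the random variable on $\Omega$ given by $\omega\mapsto\int_{\mathbb{S}^{k-1}}\left|\sum_{j=1}^k u_jX_j(\omega)\right|^s dP_{\tilde\theta_k}(u)$. Here $\log^+ x=\max(\log x,0)$ for $x>0$ and $\log^+0=0$. No independence among the $X_k$ is assumed. *)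

theory Defs
  imports "HOL-Probability.Probability"
begin

text \<open>
  Since the dimension k varies inside the theorem, Euclidean k-space is represented by the
  extensional functions on the index set \<open>{1..k}\<close> with the product Borel sigma-algebra.
\<close>

definition eucl :: "nat \<Rightarrow> (nat \<Rightarrow> real) measure" where
  "eucl k = (\<Pi>\<^sub>M i\<in>{1..k}. borel)"

definition unit_sphere :: "nat \<Rightarrow> (nat \<Rightarrow> real) set" where
  "unit_sphere k = {u \<in> space (eucl k). (\<Sum>i=1..k. (u i)\<^sup>2) = 1}"

definition orthogonal_mat :: "nat \<Rightarrow> (nat \<Rightarrow> nat \<Rightarrow> real) \<Rightarrow> bool" where
  "orthogonal_mat k A \<longleftrightarrow>
     (\<forall>j\<in>{1..k}. \<forall>l\<in>{1..k}.
        (\<Sum>i=1..k. A i j * A i l) = (if j = l then 1 else 0) \<and>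
        (\<Sum>i=1..k. A j i * A l i) = (if j = l then 1 else 0))"

definition mat_app :: "nat \<Rightarrow> (nat \<Rightarrow> nat \<Rightarrow> real) \<Rightarrow> (nat \<Rightarrow> real) \<Rightarrow> (nat \<Rightarrow> real)" where
  "mat_app k A u = (\<lambda>i\<in>{1..k}. \<Sum>j=1..k. A i j * u j)"

text \<open>
  Invariance is under the full orthogonal group: for \<open>k = 1\<close> the rotations of determinant 1 are
  trivial, and the reflection is what forces the uniform distribution on the two points.
\<close>

definition uniform_on_sphere :: "nat \<Rightarrow> (nat \<Rightarrow> real) measure \<Rightarrow> bool" where
  "uniform_on_sphere k P \<longleftrightarrow>
     prob_space P \<and> sets P = sets (eucl k) \<and> emeasure P (unit_sphere k) = 1 \<and>
     (\<forall>A. orthogonal_mat k A \<longrightarrow> distr P (eucl k) (mat_app k A) = P)"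

text \<open>
  The integrand below is bounded on the unit sphere, so for \<open>s > 0\<close> and P uniform on the sphere
  the Bochner integral is a genuine one.
\<close>

definition sphere_mean :: "(nat \<Rightarrow> real) measure \<Rightarrow> nat \<Rightarrow> real \<Rightarrow> (nat \<Rightarrow> real) \<Rightarrow> real" where
  "sphere_mean P k s x = (LINT u|P. \<bar>\<Sum>j=1..k. u j * x j\<bar> powr s)"

definition log_plus :: "real \<Rightarrow> real" where
  "log_plus x = (if x > 0 then max (ln x) 0 else 0)"


subsection \<open>Existence of the uniform distribution on the sphere\<close>

text \<open>
  Lebesgue measure on the unit ball is invariant under orthogonal maps, hence so is its image
  under radial projection.
\<close>

definition leb :: "nat \<Rightarrow> (nat \<Rightarrow> real) measure" where
  "leb k = (\<Pi>\<^sub>M i\<in>{1..k}. lborel)"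

lemma sets_leb [measurable_cong, simp]: "sets (leb k) = sets (eucl k)"
  unfolding leb_def eucl_def by (intro sets_PiM_cong) auto

lemma space_leb [simp]: "space (leb k) = space (eucl k)"
  by (rule sets_eq_imp_space_eq) simp

lemma space_eucl: "space (eucl k) = extensional {1..k}"
  by (simp add: eucl_def space_PiM PiE_def)

lemma eucl_component [measurable]: "i \<in> {1..k} \<Longrightarrow> (\<lambda>u. u i) \<in> borel_measurable (eucl k)"
  unfolding eucl_def by measurable

lemma measurable_eucl_restrict:
  "(\<And>i. i \<in> {1..k} \<Longrightarrow> (\<lambda>x. f x i) \<in> borel_measurable Q) \<Longrightarrow>
     (\<lambda>x. \<lambda>i\<in>{1..k}. f x i) \<in> measurable Q (eucl k)"
  unfolding eucl_def by (rule measurable_restrict) auto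

lemma mat_app_measurable [measurable]: "mat_app k A \<in> measurable (eucl k) (eucl k)"
  unfolding mat_app_def by (rule measurable_eucl_restrict) measurable

lemma mat_app_space: "mat_app k A u \<in> space (eucl k)"
  by (simp add: mat_app_def space_eucl)

lemma sigma_finite_leb: "sigma_finite_measure (leb k)"
proof -
  interpret product_sigma_finite "\<lambda>_::nat. lborel :: real measure" by standard
  show ?thesis unfolding leb_def by (rule sigma_finite) simp
qed

lemma lborel_affine_isometry:
  fixes c t :: real assumes "\<bar>c\<bar> = 1" shows "distr lborel borel (\<lambda>x. t + c * x) = lborel"
  using lborel_affine[of c t] assms by (auto simp: density_1)

lemma leb_affine:
  assumes c: "\<bar>c\<bar> = 1"
  shows "distr (leb k) (leb k) (\<lambda>u. \<lambda>i\<in>{1..k}. t i + c * u i) = leb k" (is "distr _ _ ?T = _")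
proof -
  interpret product_sigma_finite "\<lambda>_::nat. lborel :: real measure" by standard
  have T: "?T \<in> measurable (leb k) (leb k)"
    unfolding measurable_cong_sets[OF sets_leb sets_leb]
    by (rule measurable_eucl_restrict) measurable
  show ?thesis
    unfolding leb_def
  proof (rule PiM_eqI)
    fix A :: "nat \<Rightarrow> real set" assume A: "\<And>i. i \<in> {1..k} \<Longrightarrow> A i \<in> sets lborel"
    let ?B = "\<lambda>i. (\<lambda>x. t i + c * x) -` A i"
    have B: "?B i \<in> sets lborel" if "i \<in> {1..k}" for i
      using A[OF that] measurable_sets_borel[of "\<lambda>x. t i + c * x" borel "A i"] by simp
    have "emeasure (distr (Pi\<^sub>M {1..k} (\<lambda>i. lborel)) (Pi\<^sub>M {1..k} (\<lambda>i. lborel)) ?T) (Pi\<^sub>E {1..k} A)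
        = emeasure (Pi\<^sub>M {1..k} (\<lambda>i. lborel)) (?T -` Pi\<^sub>E {1..k} A \<inter> space (Pi\<^sub>M {1..k} (\<lambda>i. lborel)))"
      using A T by (intro emeasure_distr) (auto simp: leb_def intro!: sets_PiM_I_finite)
    also have "?T -` Pi\<^sub>E {1..k} A \<inter> space (Pi\<^sub>M {1..k} (\<lambda>i. lborel)) = Pi\<^sub>E {1..k} ?B"
      by (auto simp: space_PiM PiE_def Pi_def)
    also have "emeasure (Pi\<^sub>M {1..k} (\<lambda>i. lborel)) \<dots> = (\<Prod>i\<in>{1..k}. emeasure lborel (?B i))"
      using B by (intro emeasure_PiM) auto
    also have "\<dots> = (\<Prod>i\<in>{1..k}. emeasure lborel (A i))"
    proof (rule prod.cong)
      fix i assume "i \<in> {1..k}"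
      then have "emeasure (distr lborel borel (\<lambda>x. t i + c * x)) (A i) = emeasure lborel (?B i)"
        using A by (subst emeasure_distr) auto
      then show "emeasure lborel (?B i) = emeasure lborel (A i)"
        by (simp add: lborel_affine_isometry[OF c])
    qed simp
    finally show "emeasure (distr (Pi\<^sub>M {1..k} (\<lambda>i. lborel)) (Pi\<^sub>M {1..k} (\<lambda>i. lborel)) ?T) (Pi\<^sub>E {1..k} A)
      = (\<Prod>i\<in>{1..k}. emeasure lborel (A i))" .
  qed simp_all
qed

lemma nn_integral_leb_affine:
  assumes c: "\<bar>c\<bar> = 1" and f: "f \<in> borel_measurable (eucl k)"
  shows "(\<integral>\<^sup>+u. f (\<lambda>i\<in>{1..k}. t i + c * u i) \<partial>leb k) = (\<integral>\<^sup>+u. f u \<partial>leb k)"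
proof -
  have "(\<integral>\<^sup>+u. f u \<partial>leb k) = (\<integral>\<^sup>+u. f u \<partial>distr (leb k) (leb k) (\<lambda>u. \<lambda>i\<in>{1..k}. t i + c * u i))"
    by (simp only: leb_affine[OF c])
  also have "\<dots> = (\<integral>\<^sup>+u. f (\<lambda>i\<in>{1..k}. t i + c * u i) \<partial>leb k)"
  proof (rule nn_integral_distr)
    show "(\<lambda>u. \<lambda>i\<in>{1..k}. t i + c * u i) \<in> measurable (leb k) (leb k)"
      unfolding measurable_cong_sets[OF sets_leb sets_leb]
      by (rule measurable_eucl_restrict) measurable
  qed (use f in simp)
  finally show ?thesis ..
qed

definition sqnorm :: "nat \<Rightarrow> (nat \<Rightarrow> real) \<Rightarrow> real" where
  "sqnorm k u = (\<Sum>i=1..k. (u i)\<^sup>2)"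

lemma sqnorm_measurable [measurable]: "sqnorm k \<in> borel_measurable (eucl k)"
  unfolding sqnorm_def by measurable

lemma sqnorm_mat_app:
  assumes "orthogonal_mat k A"
  shows "sqnorm k (mat_app k A u) = sqnorm k u"
proof -
  have "sqnorm k (mat_app k A u) = (\<Sum>i=1..k. \<Sum>j=1..k. \<Sum>l=1..k. (A i j * A i l) * (u j * u l))"
    by (simp add: sqnorm_def mat_app_def power2_eq_square sum_product mult_ac)
  also have "\<dots> = (\<Sum>j=1..k. \<Sum>i=1..k. \<Sum>l=1..k. (A i j * A i l) * (u j * u l))"
    by (rule sum.swap)
  also have "\<dots> = (\<Sum>j=1..k. \<Sum>l=1..k. \<Sum>i=1..k. (A i j * A i l) * (u j * u l))"
    by (intro sum.cong refl sum.swap)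
  also have "\<dots> = (\<Sum>j=1..k. \<Sum>l=1..k. (\<Sum>i=1..k. A i j * A i l) * (u j * u l))"
    by (simp add: sum_distrib_right)
  also have "\<dots> = (\<Sum>j=1..k. \<Sum>l=1..k. (if j = l then 1 else 0) * (u j * u l))"
    using assms by (intro sum.cong refl) (auto simp: orthogonal_mat_def)
  also have "\<dots> = sqnorm k u"
    by (simp add: sqnorm_def power2_eq_square if_distrib[of "\<lambda>x. x * _"] cong: if_cong)
  finally show ?thesis .
qed

lemma mat_app_transpose:
  assumes "orthogonal_mat k A" "i \<in> {1..k}"
  shows "(\<Sum>j=1..k. A i j * mat_app k (\<lambda>i j. A j i) v j) = v i"
proof -
  have "(\<Sum>j=1..k. A i j * mat_app k (\<lambda>i j. A j i) v j) = (\<Sum>j=1..k. \<Sum>l=1..k. A i j * A l j * v l)"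
    by (simp add: mat_app_def sum_distrib_left mult.assoc)
  also have "\<dots> = (\<Sum>l=1..k. \<Sum>j=1..k. A i j * A l j * v l)" by (rule sum.swap)
  also have "\<dots> = (\<Sum>l=1..k. (\<Sum>j=1..k. A i j * A l j) * v l)" by (simp add: sum_distrib_right)
  also have "\<dots> = (\<Sum>l=1..k. (if i = l then 1 else 0) * v l)"
    using assms by (intro sum.cong refl) (auto simp: orthogonal_mat_def)
  also have "\<dots> = v i"
    using assms(2) by (simp add: if_distrib[of "\<lambda>x. x * _"] cong: if_cong)
  finally show ?thesis .
qed

definition punctured_ball :: "nat \<Rightarrow> (nat \<Rightarrow> real) set" where
  "punctured_ball k = {u \<in> space (eucl k). 0 < sqnorm k u \<and> sqnorm k u \<le> 1}"

lemma punctured_ball_sets [measurable]: "punctured_ball k \<in> sets (eucl k)"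
  unfolding punctured_ball_def by measurable

lemma emeasure_box:
  assumes "a \<le> b"
  shows "emeasure (leb k) (\<Pi>\<^sub>E i\<in>{1..k}. {a..b}) = ennreal ((b - a) ^ k)"
proof -
  interpret product_sigma_finite "\<lambda>_::nat. lborel :: real measure" by standard
  show ?thesis unfolding leb_def
    by (subst emeasure_PiM) (use assms in \<open>auto simp: ennreal_power\<close>)
qed

lemma punctured_ball_finite: "emeasure (leb k) (punctured_ball k) < \<infinity>"
proof -
  have "u i \<in> {-1..1}" if "sqnorm k u \<le> 1" "i \<in> {1..k}" for u i
  proof -
    have "(u i)\<^sup>2 \<le> sqnorm k u"
      unfolding sqnorm_def using that(2) by (intro member_le_sum) auto
    then have "(u i)\<^sup>2 \<le> 1\<^sup>2" using that(1) by simp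
    then have "\<bar>u i\<bar> \<le> 1" using abs_le_square_iff[of "u i" 1] by simp
    then show ?thesis by auto
  qed
  then have "punctured_ball k \<subseteq> (\<Pi>\<^sub>E i\<in>{1..k}. {-1..1})"
    by (auto simp: punctured_ball_def space_eucl PiE_def)
  moreover have "(\<Pi>\<^sub>E i\<in>{1..k}. {-1..1::real}) \<in> sets (leb k)"
    unfolding leb_def by (intro sets_PiM_I_finite) auto
  ultimately have "emeasure (leb k) (punctured_ball k) \<le> emeasure (leb k) (\<Pi>\<^sub>E i\<in>{1..k}. {-1..1})"
    by (intro emeasure_mono) auto
  also have "\<dots> < \<infinity>" by (subst emeasure_box) auto
  finally show ?thesis .
qed

lemma punctured_ball_pos:
  assumes k: "k \<ge> 1" shows "0 < emeasure (leb k) (punctured_ball k)"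
proof -
  have "u \<in> punctured_ball k" if u: "u \<in> (\<Pi>\<^sub>E i\<in>{1..k}. {1/(2 * real k)..1/real k})" for u
  proof -
    have b: "1/(2 * real k) \<le> u i" "u i \<le> 1/real k" if "i \<in> {1..k}" for i
      using PiE_mem[OF u that] by auto
    have p: "0 < u i" if "i \<in> {1..k}" for i
      using k by (intro less_le_trans[OF _ b(1)[OF that]]) simp
    have pos: "0 < sqnorm k u"
      unfolding sqnorm_def using k p by (intro sum_pos) fastforce+
    have "sqnorm k u \<le> (\<Sum>i=1..k. (1/real k)\<^sup>2)"
      unfolding sqnorm_def using b p by (intro sum_mono power_mono) (auto intro: less_imp_le)
    then have "sqnorm k u \<le> 1 / real k"
      using k by (simp add: power2_eq_square)
    moreover have "1 / real k \<le> 1" using k by simp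
    ultimately have "sqnorm k u \<le> 1" by linarith
    with pos show ?thesis
      using u by (auto simp: punctured_ball_def space_eucl PiE_def)
  qed
  then have "emeasure (leb k) (\<Pi>\<^sub>E i\<in>{1..k}. {1/(2 * real k)..1/real k})
      \<le> emeasure (leb k) (punctured_ball k)"
    by (intro emeasure_mono) auto
  moreover have "0 < emeasure (leb k) (\<Pi>\<^sub>E i\<in>{1..k}. {1/(2 * real k)..1/real k})"
    using k by (subst emeasure_box) (auto simp: divide_simps)
  ultimately show ?thesis by simp
qed

text \<open>
  Orthogonal invariance of Lebesgue measure: both sides agree on the ball, and Fubini together
  with translation invariance shows that they are proportional.
\<close>

lemma leb_orthogonal:
  assumes A: "orthogonal_mat k A" and k: "k \<ge> 1" and E: "E \<in> sets (eucl k)"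
  shows "emeasure (leb k) (mat_app k A -` E \<inter> space (eucl k)) = emeasure (leb k) E"
proof -
  interpret sigma_finite_measure "leb k" by (rule sigma_finite_leb)
  interpret pair_sigma_finite "leb k" "leb k" ..
  define D where "D = punctured_ball k"
  let ?L = "leb k" and ?I = "{1..k}" and ?a = "mat_app k A"
  have D: "D \<in> sets (eucl k)" unfolding D_def by measurable
  note [measurable] = E D
  have a_plus: "?a (\<lambda>i\<in>?I. mat_app k (\<lambda>i j. A j i) v i + 1 * x i) = (\<lambda>i\<in>?I. v i + ?a x i)" for v x
    using mat_app_transpose[OF A, of _ v]
    by (auto simp: mat_app_def algebra_simps sum.distrib fun_eq_iff restrict_def)
  have m1: "(\<lambda>y. \<lambda>i\<in>?I. ?a x i + c * y i) \<in> measurable ?L (eucl k)" for x c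
    unfolding measurable_cong_sets[OF sets_leb refl]
    by (rule measurable_eucl_restrict) measurable
  have m2: "(\<lambda>x. \<lambda>i\<in>?I. ?a x i + c * y i) \<in> measurable (eucl k) (eucl k)" for y c
    by (rule measurable_eucl_restrict) (auto simp: mat_app_def)
  have a_comp: "(\<lambda>z. ?a (fst z) i) \<in> borel_measurable (eucl k \<Otimes>\<^sub>M eucl k)"
    "(\<lambda>z. snd z i) \<in> borel_measurable (eucl k \<Otimes>\<^sub>M eucl k)" if "i \<in> ?I" for i
    using that by measurable
  have pair: "sets (?L \<Otimes>\<^sub>M ?L) = sets (eucl k \<Otimes>\<^sub>M eucl k)"
    by (intro sets_pair_measure_cong) auto
  have mp: "(\<lambda>z. \<lambda>i\<in>?I. ?a (fst z) i + c * snd z i) \<in> measurable (eucl k \<Otimes>\<^sub>M eucl k) (eucl k)" for c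
    by (rule measurable_eucl_restrict) (use a_comp in measurable)
  have i1: "(\<integral>\<^sup>+x. indicator E (?a x) \<partial>?L) = emeasure ?L (?a -` E \<inter> space (eucl k))"
    if [measurable]: "E \<in> sets (eucl k)" for E
  proof -
    have "(\<integral>\<^sup>+x. indicator E (?a x) \<partial>?L) = (\<integral>\<^sup>+x. indicator (?a -` E \<inter> space (eucl k)) x \<partial>?L)"
      by (intro nn_integral_cong) (auto simp: indicator_def)
    also have "\<dots> = emeasure ?L (?a -` E \<inter> space (eucl k))"
      by (rule nn_integral_indicator) (use measurable_sets[OF mat_app_measurable that] in auto)
    finally show ?thesis .
  qed
  have DD: "?a -` D \<inter> space (eucl k) = D"
    by (auto simp: D_def punctured_ball_def sqnorm_mat_app[OF A] mat_app_space)
  have "emeasure ?L (?a -` E \<inter> space (eucl k)) * emeasure ?L D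
      = (\<integral>\<^sup>+x. indicator E (?a x) * (\<integral>\<^sup>+y. indicator D y \<partial>?L) \<partial>?L)"
    by (simp add: i1[symmetric] E nn_integral_multc)
  also have "\<dots> = (\<integral>\<^sup>+x. indicator E (?a x) * (\<integral>\<^sup>+y. indicator D (\<lambda>i\<in>?I. ?a x i + 1 * y i) \<partial>?L) \<partial>?L)"
    by (subst nn_integral_leb_affine) auto
  also have "\<dots> = (\<integral>\<^sup>+x. \<integral>\<^sup>+y. indicator E (?a x) * indicator D (\<lambda>i\<in>?I. ?a x i + 1 * y i) \<partial>?L \<partial>?L)"
    by (intro nn_integral_cong nn_integral_cmult[symmetric]
        measurable_compose[OF m1 borel_measurable_indicator[OF D]])
  also have "\<dots> = (\<integral>\<^sup>+y. \<integral>\<^sup>+x. indicator E (?a x) * indicator D (\<lambda>i\<in>?I. ?a x i + 1 * y i) \<partial>?L \<partial>?L)"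
  proof (rule Fubini'[symmetric])
    show "(\<lambda>(x, y). indicator E (?a x) * indicator D (\<lambda>i\<in>?I. ?a x i + 1 * y i) :: ennreal)
        \<in> borel_measurable (?L \<Otimes>\<^sub>M ?L)"
      unfolding measurable_cong_sets[OF pair refl] split_beta
      by (intro borel_measurable_times_ennreal
          measurable_compose[OF mp borel_measurable_indicator[OF D]]) measurable
  qed
  also have "\<dots> = (\<integral>\<^sup>+y. \<integral>\<^sup>+x. indicator E (\<lambda>i\<in>?I. ?a x i + (-1) * y i) * indicator D (?a x) \<partial>?L \<partial>?L)"
  proof (rule nn_integral_cong)
    fix y assume y: "y \<in> space ?L"
    let ?f = "\<lambda>x. indicator E (\<lambda>i\<in>?I. ?a x i + (-1) * y i) * indicator D (?a x) :: ennreal"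
    have "(\<integral>\<^sup>+x. ?f x \<partial>?L) = (\<integral>\<^sup>+x. ?f (\<lambda>i\<in>?I. mat_app k (\<lambda>i j. A j i) y i + 1 * x i) \<partial>?L)"
    proof (rule nn_integral_leb_affine[symmetric])
      show "?f \<in> borel_measurable (eucl k)"
        by (intro borel_measurable_times_ennreal measurable_compose[OF m2 borel_measurable_indicator[OF E]])
          measurable
    qed simp
    also have "\<dots> = (\<integral>\<^sup>+x. indicator E (?a x) * indicator D (\<lambda>i\<in>?I. ?a x i + 1 * y i) \<partial>?L)"
    proof (rule nn_integral_cong)
      fix x
      have "(\<lambda>i\<in>?I. (\<lambda>i\<in>?I. y i + ?a x i) i + (-1) * y i) = ?a x"
        by (auto simp: mat_app_def fun_eq_iff)
      moreover have "(\<lambda>i\<in>?I. y i + ?a x i) = (\<lambda>i\<in>?I. ?a x i + 1 * y i)"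
        by (auto simp: fun_eq_iff)
      ultimately show "?f (\<lambda>i\<in>?I. mat_app k (\<lambda>i j. A j i) y i + 1 * x i) =
          indicator E (?a x) * indicator D (\<lambda>i\<in>?I. ?a x i + 1 * y i)"
        by (simp only: a_plus)
    qed
    finally show "(\<integral>\<^sup>+x. indicator E (?a x) * indicator D (\<lambda>i\<in>?I. ?a x i + 1 * y i) \<partial>?L)
      = (\<integral>\<^sup>+x. ?f x \<partial>?L)" ..
  qed
  also have "\<dots> = (\<integral>\<^sup>+x. \<integral>\<^sup>+y. indicator E (\<lambda>i\<in>?I. ?a x i + (-1) * y i) * indicator D (?a x) \<partial>?L \<partial>?L)"
  proof (rule Fubini')
    show "(\<lambda>(x, y). indicator E (\<lambda>i\<in>?I. ?a x i + (-1) * y i) * indicator D (?a x) :: ennreal)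
        \<in> borel_measurable (?L \<Otimes>\<^sub>M ?L)"
      unfolding measurable_cong_sets[OF pair refl] split_beta
      by (intro borel_measurable_times_ennreal
          measurable_compose[OF mp borel_measurable_indicator[OF E]]) measurable
  qed
  also have "\<dots> = (\<integral>\<^sup>+x. (\<integral>\<^sup>+y. indicator E (\<lambda>i\<in>?I. ?a x i + (-1) * y i) \<partial>?L) * indicator D (?a x) \<partial>?L)"
    by (intro nn_integral_cong nn_integral_multc
        measurable_compose[OF m1 borel_measurable_indicator[OF E]])
  also have "\<dots> = (\<integral>\<^sup>+x. emeasure ?L E * indicator D (?a x) \<partial>?L)"
    by (subst nn_integral_leb_affine) auto
  also have "\<dots> = emeasure ?L E * emeasure ?L D"
    by (simp add: nn_integral_cmult i1 D DD)
  finally show ?thesis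
    using punctured_ball_pos[OF k] punctured_ball_finite[of k]
    by (auto simp: D_def[symmetric] mult.commute[of _ "emeasure ?L D"] ennreal_mult_cancel_left)
qed

theorem uniform_on_sphere_exists:
  assumes k: "k \<ge> 1"
  shows "\<exists>P. uniform_on_sphere k P"
proof -
  define D where "D = punctured_ball k"
  define Q where "Q = uniform_measure (leb k) D"
  define \<pi> where "\<pi> u = (\<lambda>i\<in>{1..k}. u i / sqrt (sqnorm k u))" for u
  define P where "P = distr Q (eucl k) \<pi>"
  have D [measurable]: "D \<in> sets (eucl k)" unfolding D_def by measurable
  have D_pos: "emeasure (leb k) D \<noteq> 0" "emeasure (leb k) D \<noteq> \<infinity>"
    using punctured_ball_pos[OF k] punctured_ball_finite[of k] by (auto simp: D_def)
  have setsQ [measurable_cong, simp]: "sets Q = sets (eucl k)" by (simp add: Q_def)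
  have spaceQ [simp]: "space Q = space (eucl k)" by (rule sets_eq_imp_space_eq) simp
  have \<pi> [measurable]: "\<pi> \<in> measurable (eucl k) (eucl k)"
    unfolding \<pi>_def by (rule measurable_eucl_restrict) measurable
  have Q: "prob_space Q" unfolding Q_def using D_pos by (intro prob_space_uniform_measure) auto
  then have prob: "prob_space P" unfolding P_def by (intro prob_space.prob_space_distr) auto
  have S: "unit_sphere k \<in> sets (eucl k)" unfolding unit_sphere_def by measurable
  have "AE u in Q. \<pi> u \<in> unit_sphere k"
    unfolding Q_def
  proof (rule AE_uniform_measureI)
    show "AE u in leb k. u \<in> D \<longrightarrow> \<pi> u \<in> unit_sphere k"
    proof (rule AE_I2, rule impI)
      fix u assume "u \<in> D"
      then have u: "sqnorm k u > 0" by (simp add: D_def punctured_ball_def)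
      have "(\<Sum>i=1..k. (\<pi> u i)\<^sup>2) = (\<Sum>i=1..k. (u i)\<^sup>2 / sqnorm k u)"
        using u by (intro sum.cong) (auto simp: \<pi>_def power_divide)
      also have "\<dots> = sqnorm k u / sqnorm k u" by (simp only: sqnorm_def sum_divide_distrib)
      finally show "\<pi> u \<in> unit_sphere k" using u by (simp add: unit_sphere_def space_eucl \<pi>_def)
    qed
  qed simp
  then have "AE u in P. u \<in> unit_sphere k"
    unfolding P_def using S by (subst AE_distr_iff) (auto simp: unit_sphere_def)
  then have sphere: "emeasure P (unit_sphere k) = 1"
    using S prob by (intro prob_space.emeasure_eq_1_AE) (auto simp: P_def)
  have inv: "distr P (eucl k) (mat_app k A) = P" if A: "orthogonal_mat k A" for A
  proof -
    have Q_inv: "distr Q (eucl k) (mat_app k A) = Q"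
    proof (rule measure_eqI)
      fix E assume "E \<in> sets (distr Q (eucl k) (mat_app k A))"
      then have E [measurable]: "E \<in> sets (eucl k)" by simp
      have *: "D \<inter> (mat_app k A -` E \<inter> space (eucl k)) = mat_app k A -` (D \<inter> E) \<inter> space (eucl k)"
        by (auto simp: D_def punctured_ball_def sqnorm_mat_app[OF A] mat_app_space)
      have "emeasure (distr Q (eucl k) (mat_app k A)) E = emeasure Q (mat_app k A -` E \<inter> space (eucl k))"
        by (subst emeasure_distr) auto
      also have "\<dots> = emeasure (leb k) (mat_app k A -` (D \<inter> E) \<inter> space (eucl k)) / emeasure (leb k) D"
        using measurable_sets[OF mat_app_measurable E] unfolding Q_def
        by (subst emeasure_uniform_measure) (auto simp: *)
      also have "\<dots> = emeasure Q E"
        by (subst leb_orthogonal[OF A k]) (auto simp: Q_def)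
      finally show "emeasure (distr Q (eucl k) (mat_app k A)) E = emeasure Q E" .
    qed simp
    have comm: "mat_app k A (\<pi> u) = \<pi> (mat_app k A u)" for u
      unfolding \<pi>_def sqnorm_mat_app[OF A]
      by (auto simp: mat_app_def fun_eq_iff sum_divide_distrib)
    have "distr P (eucl k) (mat_app k A) = distr Q (eucl k) (mat_app k A \<circ> \<pi>)"
      unfolding P_def by (rule distr_distr) measurable
    also have "mat_app k A \<circ> \<pi> = \<pi> \<circ> mat_app k A" by (auto simp: comm)
    also have "distr Q (eucl k) \<dots> = distr (distr Q (eucl k) (mat_app k A)) (eucl k) \<pi>"
      by (rule distr_distr[symmetric]) measurable
    also have "\<dots> = P" by (simp add: Q_inv P_def)
    finally show ?thesis .
  qed
  show ?thesis
    using prob sphere inv unfolding uniform_on_sphere_def by (intro exI[of _ P]) (simp add: P_def)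
qed

end

theory Submission
  imports Defs
begin

text \<open>
  Since \<open>r \<le> 2\<close> and a coordinate of a uniform point has second moment \<open>1 / k\<close>, Jensen's inequality
  bounds \<open>k\<close> to the power \<open>r/2\<close> times the \<open>r\<close>-th absolute spherical mean by the \<open>r\<close>-th power of the
  Euclidean norm of \<open>(X 1, \<dots>, X k)\<close>. This bound increases with \<open>k\<close>, which disposes of the maximum.
  With \<open>c = (\<epsilon> n)\<close> to the power \<open>1/r\<close>, a sum of squares exceeds \<open>c\<^sup>2\<close> only if the sum of the
  \<open>min (X j)\<^sup>2 c\<^sup>2\<close> is at least \<open>c\<^sup>2\<close>. Markov's inequality and the layer-cake formula then bound the
  probability by \<open>C n\<close> times the mean of \<open>min 1 (Y\<^sup>2 / c\<^sup>2)\<close>, and summing over \<open>n\<close> inside the mean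
  leaves a multiple of the \<open>p\<close>-th absolute moment of \<open>Y\<close>.
\<close>

section \<open>Second moments of a uniform point on the sphere\<close>

lemma orthogonal_invariant_integral:
  fixes f :: "(nat \<Rightarrow> real) \<Rightarrow> real"
  assumes "uniform_on_sphere k P" "orthogonal_mat k A" "f \<in> borel_measurable (eucl k)"
  shows "(LINT u|P. f (mat_app k A u)) = (LINT u|P. f u)"
proof -
  have [measurable_cong]: "sets P = sets (eucl k)"
    and d: "distr P (eucl k) (mat_app k A) = P"
    using assms(1,2) by (auto simp: uniform_on_sphere_def)
  have "(LINT u|P. f u) = (LINT u|distr P (eucl k) (mat_app k A). f u)" by (simp only: d)
  also have "\<dots> = (LINT u|P. f (mat_app k A u))"
    by (rule integral_distr[OF _ assms(3)]) measurable
  finally show ?thesis ..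
qed

lemma AE_unit_sphere:
  assumes "uniform_on_sphere k P"
  shows "AE u in P. (\<Sum>i=1..k. (u i)\<^sup>2) = 1"
proof -
  interpret prob_space P using assms by (simp add: uniform_on_sphere_def)
  have sP: "sets P = sets (eucl k)" using assms by (simp add: uniform_on_sphere_def)
  have "unit_sphere k \<in> sets P" unfolding sP unit_sphere_def by measurable
  moreover have "emeasure P (unit_sphere k) = 1" using assms by (simp add: uniform_on_sphere_def)
  ultimately have "AE u in P. u \<in> unit_sphere k"
    using prob_eq_1 by (simp add: emeasure_eq_measure)
  then show ?thesis by eventually_elim (simp add: unit_sphere_def)
qed

text \<open>Almost surely the squares of the coordinates sum to 1, so every coordinate is bounded by
  1 in absolute value, and so is the product.\<close>

lemma integrable_sphere_moment:
  assumes P: "uniform_on_sphere k P" and ij: "i \<in> {1..k}" "j \<in> {1..k}"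
  shows "integrable P (\<lambda>u. u i * u j)"
proof -
  interpret prob_space P using P by (simp add: uniform_on_sphere_def)
  have [measurable_cong]: "sets P = sets (eucl k)" using P by (simp add: uniform_on_sphere_def)
  show ?thesis
  proof (rule integrable_const_bound[where B=1])
    show "AE u in P. norm (u i * u j) \<le> 1"
      using AE_unit_sphere[OF P]
    proof eventually_elim
      case (elim u)
      have "\<bar>u l\<bar> \<le> 1" if "l \<in> {1..k}" for l
      proof -
        have "(u l)\<^sup>2 \<le> (\<Sum>i=1..k. (u i)\<^sup>2)" using that by (intro member_le_sum) auto
        then show ?thesis using elim abs_le_square_iff[of "u l" 1] by simp
      qed
      then show ?case using mult_mono[of "\<bar>u i\<bar>" 1 "\<bar>u j\<bar>" 1] ij by (simp add: abs_mult)
    qed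
  qed (use ij in measurable)
qed

text \<open>The reflection that flips the sign of coordinate \<open>i\<close> and fixes the others
  preserves \<open>P\<close> but negates \<open>u i * u j\<close>, so the mean equals its own
  negative.\<close>

lemma sphere_moment_offdiag:
  assumes P: "uniform_on_sphere k P" and ij: "i \<in> {1..k}" "j \<in> {1..k}" "i \<noteq> j"
  shows "(LINT u|P. u i * u j) = 0"
proof -
  define A :: "nat \<Rightarrow> nat \<Rightarrow> real" where "A a b = (if b = a then (if a = i then -1 else 1) else 0)" for a b
  have A: "orthogonal_mat k A"
    unfolding orthogonal_mat_def A_def
    by (auto simp: if_distrib[of "\<lambda>x. x * _"] sum.delta sum.delta' cong: if_cong)
  have app: "mat_app k A u l = (if l = i then - u l else u l)" if "l \<in> {1..k}" for u l
    using that by (auto simp: mat_app_def A_def if_distrib[of "\<lambda>x. x * _"] cong: if_cong)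
  have "(LINT u|P. u i * u j) = (LINT u|P. mat_app k A u i * mat_app k A u j)"
    by (rule orthogonal_invariant_integral[OF P A, symmetric]) (use ij in measurable)
  also have "\<dots> = - (LINT u|P. u i * u j)"
    using ij by (simp add: app)
  finally show ?thesis by simp
qed

text \<open>Swapping two coordinates is orthogonal, so all \<open>k\<close> second moments agree.
  Their sum is the mean of the squared norm, which is 1.\<close>

lemma sphere_moment_diag:
  assumes P: "uniform_on_sphere k P" and i: "i \<in> {1..k}"
  shows "(LINT u|P. u i * u i) = 1 / real k"
proof -
  interpret prob_space P using P by (simp add: uniform_on_sphere_def)
  have eq: "(LINT u|P. u j * u j) = (LINT u|P. u i * u i)" if j: "j \<in> {1..k}" for j
  proof -
    define t where "t = Transposition.transpose i j"
    define A :: "nat \<Rightarrow> nat \<Rightarrow> real" where "A a b = (if b = t a then 1 else 0)" for a b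
    have t: "t a \<in> {1..k}" if "a \<in> {1..k}" for a
      using that i j by (auto simp: t_def Transposition.transpose_def)
    have tt: "a = t b \<longleftrightarrow> t a = b" for a b by (auto simp: t_def)
    have inj: "t a = t b \<longleftrightarrow> a = b" for a b by (metis t_def transpose_involutory)
    \<comment> \<open>As \<open>t\<close> is its own inverse, the nonzero entry can be located from
      either index. Column sums use \<open>A'\<close>, row sums use \<open>A_def\<close>; in both a
      single term survives.\<close>
    have A': "A a b = (if a = t b then 1 else 0)" for a b using tt[of a b] by (auto simp: A_def)
    have "(\<Sum>a=1..k. A a b * A a c) = (if b = c then 1 else 0)" if "b \<in> {1..k}" for b c
      using t[OF that] unfolding A'
      by (auto simp: if_distrib[of "\<lambda>x. x * _"] inj cong: if_cong)
    moreover have "(\<Sum>a=1..k. A b a * A c a) = (if b = c then 1 else 0)" if "b \<in> {1..k}" for b c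
      using t[OF that] unfolding A_def
      by (auto simp: if_distrib[of "\<lambda>x. x * _"] inj cong: if_cong)
    ultimately have A: "orthogonal_mat k A" by (simp add: orthogonal_mat_def)
    have app: "mat_app k A u i = u j" for u
      using i j by (auto simp: mat_app_def A_def t_def if_distrib[of "\<lambda>x. x * _"] cong: if_cong)
    have "(LINT u|P. mat_app k A u i * mat_app k A u i) = (LINT u|P. u i * u i)"
      by (rule orthogonal_invariant_integral[OF P A]) (use i in measurable)
    then show ?thesis by (simp add: app)
  qed
  have "real k * (LINT u|P. u i * u i) = (\<Sum>j=1..k. LINT u|P. u i * u i)" by simp
  also have "\<dots> = (\<Sum>j=1..k. LINT u|P. u j * u j)"
    by (intro sum.cong refl eq[symmetric])
  also have "\<dots> = (LINT u|P. (\<Sum>j=1..k. u j * u j))"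
    by (rule Bochner_Integration.integral_sum[symmetric]) (rule integrable_sphere_moment[OF P])
  also have "\<dots> = (LINT u|P. 1)"
  proof (rule integral_cong_AE)
    have sP: "sets P = sets (eucl k)" using P by (simp add: uniform_on_sphere_def)
    show "(\<lambda>u. \<Sum>j=1..k. u j * u j) \<in> borel_measurable P"
      unfolding measurable_cong_sets[OF sP refl] by measurable
  qed (use AE_unit_sphere[OF P] in \<open>auto simp: power2_eq_square\<close>)
  also have "\<dots> = 1" by (simp add: prob_space)
  finally show ?thesis using i by (simp add: field_simps)
qed

text \<open>After expanding the square into a double sum, the mixed moments vanish and each diagonal
  one contributes \<open>1 / real k\<close>.\<close>

lemma sphere_second_moment:
  assumes P: "uniform_on_sphere k P"
  shows "integrable P (\<lambda>u. (\<Sum>j=1..k. u j * x j)\<^sup>2)"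
    and "(LINT u|P. (\<Sum>j=1..k. u j * x j)\<^sup>2) = (\<Sum>j=1..k. (x j)\<^sup>2) / real k"
proof -
  have sq: "(\<Sum>j=1..k. u j * x j)\<^sup>2 = (\<Sum>i=1..k. \<Sum>j=1..k. (x i * x j) * (u i * u j))" for u :: "nat \<Rightarrow> real"
    by (simp add: power2_eq_square sum_product mult_ac)
  have int: "integrable P (\<lambda>u. (x i * x j) * (u i * u j))" if "i \<in> {1..k}" "j \<in> {1..k}" for i j
    using integrable_sphere_moment[OF P that] by simp
  show "integrable P (\<lambda>u. (\<Sum>j=1..k. u j * x j)\<^sup>2)"
    unfolding sq by (intro Bochner_Integration.integrable_sum int)
  have "(LINT u|P. (\<Sum>j=1..k. u j * x j)\<^sup>2)
      = (\<Sum>i=1..k. LINT u|P. (\<Sum>j=1..k. (x i * x j) * (u i * u j)))"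
    unfolding sq by (intro Bochner_Integration.integral_sum Bochner_Integration.integrable_sum int)
  also have "\<dots> = (\<Sum>i=1..k. \<Sum>j=1..k. (x i * x j) * (LINT u|P. u i * u j))"
    using int by (intro sum.cong refl) (simp add: Bochner_Integration.integral_sum)
  also have "\<dots> = (\<Sum>i=1..k. \<Sum>j=1..k. if i = j then x i * x j / real k else 0)"
    by (intro sum.cong refl)
      (auto simp: sphere_moment_offdiag[OF P] sphere_moment_diag[OF P])
  also have "\<dots> = (\<Sum>j=1..k. (x j)\<^sup>2) / real k"
    by (simp add: power2_eq_square sum_divide_distrib)
  finally show "(LINT u|P. (\<Sum>j=1..k. u j * x j)\<^sup>2) = (\<Sum>j=1..k. (x j)\<^sup>2) / real k" .
qed

section \<open>Jensen's inequality for spherical means, and removal of the maximum\<close>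

text \<open>A concave power lies below its tangent at \<open>a\<close>; choosing \<open>a\<close> as
  the mean of \<open>y\<close> and integrating gives Jensen's inequality. The proof uses convexity
  of \<open>exp\<close> between 0 and \<open>ln (y / a)\<close> with weight \<alpha>, then rescales
  by \<open>a powr \<alpha>\<close>.\<close>

lemma powr_le_tangent:
  fixes y a \<alpha> :: real
  assumes "0 < a" "0 \<le> y" "0 < \<alpha>" "\<alpha> \<le> 1"
  shows "y powr \<alpha> \<le> a powr \<alpha> * (1 - \<alpha>) + a powr \<alpha> * \<alpha> / a * y"
proof (cases "y = 0")
  case False
  then have y: "y > 0" using assms by simp
  have "exp ((1 - \<alpha>) * 0 + \<alpha> * ln (y / a)) \<le> (1 - \<alpha>) * exp 0 + \<alpha> * exp (ln (y / a))"
    using assms convex_onD[OF exp_convex, of \<alpha> 0 "ln (y/a)"] by simp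
  then have "(y / a) powr \<alpha> \<le> (1 - \<alpha>) + \<alpha> * (y / a)"
    using y assms by (simp add: powr_def)
  then have "a powr \<alpha> * (y / a) powr \<alpha> \<le> a powr \<alpha> * ((1 - \<alpha>) + \<alpha> * (y / a))"
    by (intro mult_left_mono) auto
  moreover have "a powr \<alpha> * (y / a) powr \<alpha> = y powr \<alpha>"
    using y assms by (simp flip: powr_mult)
  ultimately show ?thesis by (simp add: algebra_simps)
qed (use assms in simp)

text \<open>Jensen for the exponent \<open>r / 2\<close>, at most 1, applied to the squared linear
  form, whose mean is \<open>a\<close>. The case \<open>a = 0\<close> is separate because the
  tangent needs a positive base point; there all relevant \<open>x j\<close> vanish.\<close>

lemma sphere_mean_le:
  assumes P: "uniform_on_sphere k P" and r: "0 < r" "r \<le> 2"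
  shows "sphere_mean P k r x \<le> ((\<Sum>j=1..k. (x j)\<^sup>2) / real k) powr (r / 2)"
proof -
  interpret prob_space P using P by (simp add: uniform_on_sphere_def)
  define a where "a = (\<Sum>j=1..k. (x j)\<^sup>2) / real k"
  have a0: "a \<ge> 0" by (simp add: a_def sum_nonneg)
  have "sphere_mean P k r x \<le> a powr (r / 2)"
  proof (cases "a = 0")
    case True
    then have "\<forall>j\<in>{1..k}. x j = 0"
      by (auto simp: a_def sum_nonneg_eq_0_iff)
    then have "sphere_mean P k r x = 0" by (simp add: sphere_mean_def)
    then show ?thesis by simp
  next
    case False
    then have a: "a > 0" using a0 by simp
    let ?S = "\<lambda>u. \<Sum>j=1..k. u j * x j"
    let ?b = "\<lambda>u. a powr (r/2) * (1 - r/2) + a powr (r/2) * (r/2) / a * (?S u)\<^sup>2"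
    have le: "\<bar>?S u\<bar> powr r \<le> ?b u" for u :: "nat \<Rightarrow> real"
    proof -
      have "\<bar>?S u\<bar> powr r = ((?S u)\<^sup>2) powr (r / 2)"
        using powr_powr[of "\<bar>?S u\<bar>" 2 "r/2"] by (simp add: powr_numeral)
      also have "\<dots> \<le> ?b u"
        using powr_le_tangent[of a "(?S u)\<^sup>2" "r/2"] a r by simp
      finally show ?thesis .
    qed
    note m = sphere_second_moment[OF P, of x]
    \<comment> \<open>The majorant \<open>?b\<close> is nonnegative and integrable, and it is affine
      in the squared form. Its mean is therefore the tangent evaluated at \<open>a\<close>, that is
      \<open>a powr (r/2)\<close>.\<close>
    have "sphere_mean P k r x \<le> (LINT u|P. ?b u)"
      unfolding sphere_mean_def
      using m(1) le order_trans[OF powr_ge_zero le] by (intro integral_mono') auto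
    also have "\<dots> = a powr (r/2) * (1 - r/2) + a powr (r/2) * (r/2) / a * a"
      using m by (simp add: prob_space a_def)
    also have "\<dots> = a powr (r/2)" using a by (simp add: algebra_simps)
    finally show ?thesis .
  qed
  then show ?thesis by (simp add: a_def)
qed

text \<open>At an index \<open>k\<close> where the maximum exceeds \<open>e\<close>, the factor
  \<open>real k powr (r / 2)\<close> cancels the division by \<open>k\<close> in the Jensen bound.
  What remains is a power of a partial sum of squares, which only grows when \<open>k\<close> is
  replaced by \<open>n\<close>.\<close>

lemma max_sphere_mean_gt_imp_sum_squares_gt:
  assumes P: "\<And>k. k \<ge> 1 \<Longrightarrow> uniform_on_sphere k (P k)"
    and r: "0 < r" "r \<le> 2" and n: "n \<ge> 1" and e: "e \<ge> 0"
    and gt: "(MAX k\<in>{1..n}. real k powr (r / 2) * sphere_mean (P k) k r x) > e"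
  shows "(\<Sum>j=1..n. (x j)\<^sup>2) > e powr (2 / r)"
proof -
  obtain k where k: "k \<in> {1..n}" "real k powr (r / 2) * sphere_mean (P k) k r x > e"
    using gt n by (subst (asm) Max_gr_iff) auto
  have "e < real k powr (r / 2) * ((\<Sum>j=1..k. (x j)\<^sup>2) / real k) powr (r / 2)"
    using k sphere_mean_le[OF P r, of k x] by (intro less_le_trans[OF k(2)] mult_left_mono) auto
  also have "\<dots> = (\<Sum>j=1..k. (x j)\<^sup>2) powr (r / 2)"
    using k by (simp add: sum_nonneg flip: powr_mult)
  also have "\<dots> \<le> (\<Sum>j=1..n. (x j)\<^sup>2) powr (r / 2)"
    using k r by (intro powr_mono2 sum_mono2) (auto intro: sum_nonneg)
  finally have "e powr (2/r) < ((\<Sum>j=1..n. (x j)\<^sup>2) powr (r / 2)) powr (2 / r)"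
    using e r by (intro powr_less_mono2) auto
  also have "\<dots> = (\<Sum>j=1..n. (x j)\<^sup>2)"
    using r by (simp add: powr_powr sum_nonneg)
  finally show ?thesis .
qed

section \<open>Layer-cake formula and truncated second moments\<close>

lemma nn_integral_min_square:
  fixes a c :: real
  assumes "c \<ge> 0"
  shows "(\<integral>\<^sup>+x. ennreal (2 * x) * indicator {0<..<c} x * indicator {x. x < \<bar>a\<bar>} x \<partial>lborel)
    = ennreal (min (a\<^sup>2) (c\<^sup>2))"
proof -
  define m where "m = min \<bar>a\<bar> c"
  have m: "m \<ge> 0" using assms by (simp add: m_def)
  have "(\<integral>\<^sup>+x. ennreal (2 * x) * indicator {0<..<c} x * indicator {x. x < \<bar>a\<bar>} x \<partial>lborel)
      = (\<integral>\<^sup>+x. ennreal (2 * x) * indicator {0..m} x \<partial>lborel)"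
    \<comment> \<open>The integrands differ at most at \<open>m\<close>, a null set; at 0 the weight
      \<open>2 * x\<close> vanishes.\<close>
    using AE_lborel_singleton[of m] by (intro nn_integral_cong_AE) (auto simp: m_def indicator_def)
  also have "\<dots> = m\<^sup>2 - 0\<^sup>2"
    by (rule nn_integral_FTC_Icc) (use m in \<open>auto intro!: derivative_eq_intros\<close>)
  also have "m\<^sup>2 - 0\<^sup>2 = min (a\<^sup>2) (c\<^sup>2)"
    using assms by (auto simp: m_def min_def abs_le_square_iff[symmetric])
  finally show ?thesis .
qed

text \<open>The pointwise identity \<open>nn_integral_min_square\<close> is integrated over
  \<open>M\<close> and the order of integration is exchanged. This expresses a truncated moment
  through tail probabilities, the only quantities that the domination hypothesis controls.\<close>

lemma nn_integral_truncated_square: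
  fixes X :: "'a \<Rightarrow> real"
  assumes "sigma_finite_measure M" and [measurable]: "X \<in> borel_measurable M" and "c \<ge> 0"
  shows "(\<integral>\<^sup>+\<omega>. ennreal (min ((X \<omega>)\<^sup>2) (c\<^sup>2)) \<partial>M)
    = (\<integral>\<^sup>+x. ennreal (2 * x) * indicator {0<..<c} x * emeasure M {\<omega> \<in> space M. \<bar>X \<omega>\<bar> > x} \<partial>lborel)"
proof -
  interpret sigma_finite_measure M by fact
  interpret pair_sigma_finite lborel M ..
  have "(\<integral>\<^sup>+\<omega>. ennreal (min ((X \<omega>)\<^sup>2) (c\<^sup>2)) \<partial>M)
      = (\<integral>\<^sup>+\<omega>. \<integral>\<^sup>+x. ennreal (2 * x) * indicator {0<..<c} x * indicator {x. x < \<bar>X \<omega>\<bar>} x \<partial>lborel \<partial>M)"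
    by (simp add: nn_integral_min_square[OF \<open>c \<ge> 0\<close>])
  also have "\<dots> = (\<integral>\<^sup>+x. \<integral>\<^sup>+\<omega>. ennreal (2 * x) * indicator {0<..<c} x * indicator {x. x < \<bar>X \<omega>\<bar>} x \<partial>M \<partial>lborel)"
    by (rule Fubini') (simp add: indicator_def split_beta)
  also have "\<dots> = (\<integral>\<^sup>+x. ennreal (2 * x) * indicator {0<..<c} x * emeasure M {\<omega> \<in> space M. \<bar>X \<omega>\<bar> > x} \<partial>lborel)"
  proof (rule nn_integral_cong)
    fix x :: real
    have "(\<integral>\<^sup>+\<omega>. ennreal (2 * x) * indicator {0<..<c} x * indicator {x. x < \<bar>X \<omega>\<bar>} x \<partial>M)
        = (\<integral>\<^sup>+\<omega>. ennreal (2 * x) * indicator {0<..<c} x * indicator {\<omega> \<in> space M. \<bar>X \<omega>\<bar> > x} \<omega> \<partial>M)"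
      by (intro nn_integral_cong) (simp add: indicator_def)
    also have "\<dots> = ennreal (2 * x) * indicator {0<..<c} x * emeasure M {\<omega> \<in> space M. \<bar>X \<omega>\<bar> > x}"
      by (rule nn_integral_cmult_indicator) measurable
    finally show "(\<integral>\<^sup>+\<omega>. ennreal (2 * x) * indicator {0<..<c} x * indicator {x. x < \<bar>X \<omega>\<bar>} x \<partial>M)
      = ennreal (2 * x) * indicator {0<..<c} x * emeasure M {\<omega> \<in> space M. \<bar>X \<omega>\<bar> > x}" .
  qed
  finally show ?thesis .
qed

lemma integrable_truncated_square:
  fixes X :: "'a \<Rightarrow> real"
  assumes "finite_measure M" and [measurable]: "X \<in> borel_measurable M"
  shows "integrable M (\<lambda>\<omega>. min ((X \<omega>)\<^sup>2) (c\<^sup>2))"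
  by (rule finite_measure.integrable_const_bound[OF assms(1), where B = "c\<^sup>2"]) auto

text \<open>Both sides are integrals of tails against the same nonnegative weight, so the inequality
  between tails can be integrated. The weight is supported in the interval from 0 to
  \<open>c\<close>, hence only tails at \<open>x > 0\<close> matter.\<close>

lemma truncated_square_dominated:
  fixes X :: "'i \<Rightarrow> 'a \<Rightarrow> real" and Y :: "'b \<Rightarrow> real"
  assumes M: "finite_measure M" and X: "\<And>k. k \<in> I \<Longrightarrow> X k \<in> borel_measurable M"
    and N: "finite_measure N" and Y: "Y \<in> borel_measurable N" and "c \<ge> 0" "D \<ge> 0"
    and dom: "\<And>x. x > 0 \<Longrightarrow> (\<Sum>k\<in>I. measure M {\<omega> \<in> space M. \<bar>X k \<omega>\<bar> > x})
                \<le> D * measure N {\<omega> \<in> space N. \<bar>Y \<omega>\<bar> > x}"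
  shows "(\<Sum>k\<in>I. LINT \<omega>|M. min ((X k \<omega>)\<^sup>2) (c\<^sup>2)) \<le> D * (LINT \<omega>|N. min ((Y \<omega>)\<^sup>2) (c\<^sup>2))"
proof -
  interpret M: finite_measure M by fact
  interpret N: finite_measure N by fact
  have nn: "ennreal (LINT \<omega>|L. min ((Z \<omega>)\<^sup>2) (c\<^sup>2))
      = (\<integral>\<^sup>+x. ennreal (2 * x) * indicator {0<..<c} x * ennreal (measure L {\<omega> \<in> space L. \<bar>Z \<omega>\<bar> > x}) \<partial>lborel)"
    if L: "finite_measure L" and Z: "Z \<in> borel_measurable L" for L :: "'c measure" and Z
  proof -
    interpret finite_measure L by fact
    show ?thesis
      using nn_integral_truncated_square[OF sigma_finite_measure_axioms Z \<open>c \<ge> 0\<close>]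
        integrable_truncated_square[OF L Z]
      by (simp add: nn_integral_eq_integral emeasure_eq_measure)
  qed
  let ?w = "\<lambda>x::real. ennreal (2 * x) * indicator {0<..<c} x :: ennreal"
  have meas: "(\<lambda>x. ?w x * ennreal (measure L {\<omega> \<in> space L. \<bar>Z \<omega>\<bar> > x})) \<in> borel_measurable lborel"
    if L: "finite_measure L" and [measurable]: "Z \<in> borel_measurable L" for L :: "'c measure" and Z :: "'c \<Rightarrow> real"
  proof -
    interpret finite_measure L by fact
    \<comment> \<open>A tail is a monotone function of the level, which makes it Borel.\<close>
    have "antimono (\<lambda>x. measure L {\<omega> \<in> space L. \<bar>Z \<omega>\<bar> > x})"
      by (intro antimonoI finite_measure_mono) auto
    then have "mono (\<lambda>x. - measure L {\<omega> \<in> space L. \<bar>Z \<omega>\<bar> > x})"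
      by (auto simp: mono_def antimono_def)
    from borel_measurable_uminus[OF borel_measurable_mono[OF this]]
    have "(\<lambda>x. measure L {\<omega> \<in> space L. \<bar>Z \<omega>\<bar> > x}) \<in> borel_measurable lborel" by simp
    then show ?thesis
      by (intro borel_measurable_times_ennreal borel_measurable_indicator
          measurable_compose[OF _ measurable_ennreal]) auto
  qed
  have "ennreal (\<Sum>k\<in>I. LINT \<omega>|M. min ((X k \<omega>)\<^sup>2) (c\<^sup>2))
      = (\<Sum>k\<in>I. ennreal (LINT \<omega>|M. min ((X k \<omega>)\<^sup>2) (c\<^sup>2)))"
    by (rule sum_ennreal[symmetric]) simp
  also have "\<dots> = (\<Sum>k\<in>I. \<integral>\<^sup>+x. ?w x * ennreal (measure M {\<omega> \<in> space M. \<bar>X k \<omega>\<bar> > x}) \<partial>lborel)"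
    by (intro sum.cong refl nn[OF M X])
  also have "\<dots> = (\<integral>\<^sup>+x. (\<Sum>k\<in>I. ?w x * ennreal (measure M {\<omega> \<in> space M. \<bar>X k \<omega>\<bar> > x})) \<partial>lborel)"
    by (rule nn_integral_sum[symmetric]) (rule meas[OF M X])
  also have "\<dots> = (\<integral>\<^sup>+x. ?w x * ennreal (\<Sum>k\<in>I. measure M {\<omega> \<in> space M. \<bar>X k \<omega>\<bar> > x}) \<partial>lborel)"
    by (simp add: sum_distrib_left flip: sum_ennreal)
  also have "\<dots> \<le> (\<integral>\<^sup>+x. ?w x * ennreal (D * measure N {\<omega> \<in> space N. \<bar>Y \<omega>\<bar> > x}) \<partial>lborel)"
    by (intro nn_integral_mono) (auto intro!: mult_left_mono ennreal_leI dom simp: indicator_def)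
  also have "\<dots> = (\<integral>\<^sup>+x. ennreal D * (?w x * ennreal (measure N {\<omega> \<in> space N. \<bar>Y \<omega>\<bar> > x})) \<partial>lborel)"
    using \<open>D \<ge> 0\<close> by (simp add: ennreal_mult mult_ac)
  also have "\<dots> = ennreal D * ennreal (LINT \<omega>|N. min ((Y \<omega>)\<^sup>2) (c\<^sup>2))"
    unfolding nn[OF N Y] by (rule nn_integral_cmult) (rule meas[OF N Y])
  also have "\<dots> = ennreal (D * (LINT \<omega>|N. min ((Y \<omega>)\<^sup>2) (c\<^sup>2)))"
    using \<open>D \<ge> 0\<close> by (simp add: ennreal_mult')
  finally show ?thesis
    using \<open>D \<ge> 0\<close> by (subst (asm) ennreal_le_iff) auto
qed

text \<open>Truncating each square at \<open>c\<^sup>2\<close> loses nothing: if some square exceeds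
  \<open>c\<^sup>2\<close>, its truncation alone reaches the threshold; otherwise no term changes.
  Markov's inequality is then applied to the bounded, hence integrable, truncated sum.\<close>

lemma prob_sum_squares_gt_le:
  fixes X :: "'i \<Rightarrow> 'a \<Rightarrow> real"
  assumes M: "finite_measure M" and X: "\<And>k. k \<in> I \<Longrightarrow> X k \<in> borel_measurable M"
    and I: "finite I" and c: "c > 0"
  shows "measure M {\<omega> \<in> space M. (\<Sum>k\<in>I. (X k \<omega>)\<^sup>2) > c\<^sup>2}
    \<le> (\<Sum>k\<in>I. LINT \<omega>|M. min ((X k \<omega>)\<^sup>2) (c\<^sup>2)) / c\<^sup>2"
proof -
  interpret finite_measure M by fact
  note [measurable] = X
  let ?T = "\<lambda>\<omega>. \<Sum>k\<in>I. min ((X k \<omega>)\<^sup>2) (c\<^sup>2)"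
  have int: "integrable M ?T"
    by (intro Bochner_Integration.integrable_sum integrable_truncated_square M X)
  have "?T \<omega> \<ge> c\<^sup>2" if gt: "(\<Sum>k\<in>I. (X k \<omega>)\<^sup>2) > c\<^sup>2" for \<omega>
  proof (cases "\<exists>k\<in>I. (X k \<omega>)\<^sup>2 > c\<^sup>2")
    case True
    then obtain k where k: "k \<in> I" "(X k \<omega>)\<^sup>2 > c\<^sup>2" by blast
    then have "c\<^sup>2 = min ((X k \<omega>)\<^sup>2) (c\<^sup>2)" by simp
    also have "\<dots> \<le> ?T \<omega>" using k I by (intro member_le_sum) auto
    finally show ?thesis .
  next
    case False
    then have "?T \<omega> = (\<Sum>k\<in>I. (X k \<omega>)\<^sup>2)" by (intro sum.cong) auto
    then show ?thesis using gt by simp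
  qed
  then have "measure M {\<omega> \<in> space M. (\<Sum>k\<in>I. (X k \<omega>)\<^sup>2) > c\<^sup>2} \<le> measure M {\<omega> \<in> space M. ?T \<omega> \<ge> c\<^sup>2}"
    by (intro finite_measure_mono) auto
  also have "\<dots> \<le> (LINT \<omega>|M. ?T \<omega>) / c\<^sup>2"
    by (rule integral_Markov_inequality_measure[OF int, where A = "{}"])
      (use c in \<open>auto intro!: AE_I2 sum_nonneg\<close>)
  also have "(LINT \<omega>|M. ?T \<omega>) = (\<Sum>k\<in>I. LINT \<omega>|M. min ((X k \<omega>)\<^sup>2) (c\<^sup>2))"
    by (intro Bochner_Integration.integral_sum integrable_truncated_square M X)
  finally show ?thesis .
qed

section \<open>Sums of powers over finite sets of integers\<close>

text \<open>Mean value theorem for the power \<open>-d\<close> between \<open>n\<close> and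
  \<open>n + 1\<close>. The intermediate point is below \<open>n + 1\<close>, hence below
  \<open>2 * n\<close>, which is the source of the constant. The right-hand side is shaped to
  telescope.\<close>

lemma powr_neg_diff_ge:
  fixes d :: real and n :: nat
  assumes d: "d > 0" and n: "n \<ge> 1"
  shows "real n powr (-1 - d) \<le> 2 powr (1 + d) / d * (real n powr (-d) - real (Suc n) powr (-d))"
proof -
  have "\<exists>z. z > real n \<and> z < real (Suc n) \<and>
      real (Suc n) powr (-d) - real n powr (-d) = (real (Suc n) - real n) * ((-d) * z powr (-d - 1))"
    using n by (intro MVT2) (auto intro!: derivative_eq_intros)
  then obtain z where z: "z > real n" "z < real (Suc n)"
    and eq: "real n powr (-d) - real (Suc n) powr (-d) = d * z powr (-d - 1)"
    by (auto simp: algebra_simps)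
  have eq: "real n powr (-d) - real (Suc n) powr (-d) = d * z powr (-1 - d)"
    unfolding eq by (simp only: minus_diff_commute)
  have "(2 * real n) powr (-1 - d) \<le> z powr (-1 - d)"
    using z n d by (intro powr_mono2') auto
  then have "2 powr (-1 - d) * real n powr (-1 - d) \<le> z powr (-1 - d)"
    by (simp add: powr_mult)
  then have "2 powr (1 + d) * (2 powr (-1 - d) * real n powr (-1 - d)) \<le> 2 powr (1 + d) * z powr (-1 - d)"
    by (intro mult_left_mono) auto
  moreover have "2 powr (1 + d) * (2 powr (-1 - d) :: real) = 1"
    by (simp flip: powr_add)
  ultimately have "real n powr (-1 - d) \<le> 2 powr (1 + d) * z powr (-1 - d)"
    by (simp flip: mult.assoc)
  then show ?thesis unfolding eq using d by simp
qed

text \<open>\<open>F\<close> is enlarged to the integer interval from its minimum to its maximum,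
  where the bound by differences telescopes. The subtracted end term is dropped, and the first index
  exceeds \<open>z\<close>.\<close>

lemma sum_powr_tail_le:
  fixes d z :: real
  assumes d: "d > 0" and z: "z > 0" and F: "finite F" "\<And>n. n \<in> F \<Longrightarrow> real n > z"
  shows "(\<Sum>n\<in>F. real n powr (-1 - d)) \<le> 2 powr (1 + d) / d * z powr (-d)"
proof (cases "F = {}")
  case False
  define m where "m = Min F"
  have m: "m \<in> F" "\<And>n. n \<in> F \<Longrightarrow> m \<le> n" using F False by (auto simp: m_def)
  have mz: "real m > z" using F(2)[OF m(1)] .
  then have m1: "m \<ge> 1" using z by (cases m) auto
  have sub: "F \<subseteq> {m..<Suc (Max F)}" using F m by (auto simp: less_Suc_eq_le)
  have "(\<Sum>n\<in>F. real n powr (-1 - d)) \<le> (\<Sum>n=m..<Suc (Max F). real n powr (-1 - d))"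
    using sub by (intro sum_mono2) auto
  also have "\<dots> \<le> (\<Sum>n=m..<Suc (Max F). 2 powr (1 + d) / d * (real n powr (-d) - real (Suc n) powr (-d)))"
    using m1 d by (intro sum_mono powr_neg_diff_ge) auto
  also have "\<dots> = 2 powr (1 + d) / d * (\<Sum>n=m..<Suc (Max F). real n powr (-d) - real (Suc n) powr (-d))"
    by (simp only: sum_distrib_left)
  also have "(\<Sum>n=m..<Suc (Max F). real n powr (-d) - real (Suc n) powr (-d))
      = real m powr (-d) - real (Suc (Max F)) powr (-d)"
    using sum_Suc_diff'[of m "Suc (Max F)" "\<lambda>n. - (real n powr (-d))"] F m by (simp add: le_SucI)
  also have "2 powr (1 + d) / d * \<dots> \<le> 2 powr (1 + d) / d * z powr (-d)"
  proof (intro mult_left_mono)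
    have "real m powr (-d) \<le> z powr (-d)" using mz z d by (intro powr_mono2') auto
    then show "real m powr (-d) - real (Suc (Max F)) powr (-d) \<le> z powr (-d)"
      using powr_ge_zero[of "real (Suc (Max F))" "-d"] by linarith
  qed (use d in auto)
  finally show ?thesis .
qed (use d in auto)

text \<open>The sum is split at \<open>n = z\<close>. Up to \<open>z\<close> the minimum is bounded
  by 1, and at most \<open>z\<close> indices contribute at most \<open>z powr (q - 1)\<close> each,
  as \<open>q \<ge> 1\<close>. Beyond \<open>z\<close> the power is used, and the tail bound applies
  with \<open>d = s - q\<close>.\<close>

lemma sum_powr_truncated_le:
  fixes q s z :: real
  assumes q: "q \<ge> 1" and s: "s > q" and z: "z \<ge> 0" and F: "finite F" "F \<subseteq> {1..}"
  shows "(\<Sum>n\<in>F. real n powr (q - 1) * min 1 ((z / real n) powr s))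
    \<le> (1 + 2 powr (1 + (s - q)) / (s - q)) * z powr q"
proof (cases "z = 0")
  case False
  then have z: "z > 0" using z by simp
  let ?f = "\<lambda>n. real n powr (q - 1) * min 1 ((z / real n) powr s)"
  let ?A = "{n \<in> F. real n \<le> z}" and ?B = "{n \<in> F. real n > z}"
  have "sum ?f ?A \<le> (\<Sum>n\<in>?A. z powr (q - 1))"
  proof (rule sum_mono)
    fix n assume n: "n \<in> ?A"
    have "?f n \<le> real n powr (q - 1) * 1" by (intro mult_left_mono) auto
    also have "\<dots> \<le> z powr (q - 1)" using n q by (auto intro!: powr_mono2)
    finally show "?f n \<le> z powr (q - 1)" .
  qed
  also have "\<dots> = real (card ?A) * z powr (q - 1)" by simp
  also have "\<dots> \<le> z * z powr (q - 1)"
  proof (intro mult_right_mono)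
    have "?A \<subseteq> {1..nat \<lfloor>z\<rfloor>}" using F(2) by (auto simp: le_nat_floor)
    then have "card ?A \<le> nat \<lfloor>z\<rfloor>" using card_mono[of "{1..nat \<lfloor>z\<rfloor>}" ?A] by simp
    then show "real (card ?A) \<le> z" using z by linarith
  qed simp
  also have "\<dots> = z powr q" using z powr_mult_base[of z "q - 1"] by simp
  finally have A: "sum ?f ?A \<le> z powr q" .
  have "sum ?f ?B \<le> (\<Sum>n\<in>?B. z powr s * real n powr (-1 - (s - q)))"
  proof (rule sum_mono)
    fix n assume n: "n \<in> ?B"
    then have n0: "real n > 0" using z by auto
    have "?f n \<le> real n powr (q - 1) * (z / real n) powr s" by (intro mult_left_mono) auto
    also have "\<dots> = z powr s * (real n powr (q - 1) / real n powr s)"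
      using z n0 by (simp add: powr_divide)
    also have "real n powr (q - 1) / real n powr s = real n powr (-1 - (s - q))"
      by (simp add: algebra_simps flip: powr_diff)
    finally show "?f n \<le> z powr s * real n powr (-1 - (s - q))" .
  qed
  also have "\<dots> = z powr s * (\<Sum>n\<in>?B. real n powr (-1 - (s - q)))" by (simp add: sum_distrib_left)
  also have "\<dots> \<le> z powr s * (2 powr (1 + (s - q)) / (s - q) * z powr (- (s - q)))"
    using s z F by (intro mult_left_mono sum_powr_tail_le) auto
  also have "\<dots> = 2 powr (1 + (s - q)) / (s - q) * (z powr s * z powr (- (s - q)))" by simp
  also have "z powr s * z powr (- (s - q)) = z powr q" by (simp flip: powr_add)
  finally have B: "sum ?f ?B \<le> 2 powr (1 + (s - q)) / (s - q) * z powr q" .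
  have "sum ?f F = sum ?f (?A \<union> ?B)" by (rule arg_cong[where f = "sum ?f"]) auto
  also have "\<dots> = sum ?f ?A + sum ?f ?B" using F by (intro sum.union_disjoint) auto
  finally show ?thesis using A B by (simp add: algebra_simps)
qed (use F s in \<open>auto intro!: sum_nonpos\<close>)

section \<open>Summability of the probabilities\<close>

text \<open>The range \<open>r \<le> p\<close> serves both claims of the theorem: it gives
  \<open>q = p / r \<ge> 1\<close>, while \<open>p < 2\<close> gives \<open>s = 2 / r > q\<close>,
  as \<open>sum_powr_truncated_le\<close> requires.\<close>

lemma max_sphere_mean_summable:
  fixes M :: "'a measure" and X :: "nat \<Rightarrow> 'a \<Rightarrow> real"
    and N :: "'b measure" and Y :: "'b \<Rightarrow> real"
  assumes M: "finite_measure M" and X: "\<And>k. k \<ge> 1 \<Longrightarrow> X k \<in> borel_measurable M"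
    and N: "finite_measure N" and Y [measurable]: "Y \<in> borel_measurable N"
    and P: "\<And>k. k \<ge> 1 \<Longrightarrow> uniform_on_sphere k (P k)"
    and C: "C \<ge> 0"
    and dom: "\<And>x n. x > 0 \<Longrightarrow> n \<ge> 1 \<Longrightarrow>
           1 / real n * (\<Sum>k=1..n. measure M {\<omega> \<in> space M. \<bar>X k \<omega>\<bar> > x})
             \<le> C * measure N {\<omega> \<in> space N. \<bar>Y \<omega>\<bar> > x}"
    and r: "0 < r" "r \<le> p" and p: "p < 2"
    and int: "integrable N (\<lambda>\<omega>. \<bar>Y \<omega>\<bar> powr p)"
    and e: "\<epsilon> > 0"
  shows "(\<lambda>n. real n powr (p / r - 2) *
               measure M {\<omega> \<in> space M.
                 (MAX k\<in>{1..n}. real k powr (r / 2) * sphere_mean (P k) k r (\<lambda>j. X j \<omega>))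
                   > \<epsilon> * real n}) summable_on {1..}"
    (is "(\<lambda>n. _ * measure M (?E n)) summable_on _")
proof -
  interpret M: finite_measure M by fact
  define q where "q = p / r"
  define s where "s = 2 / r"
  have q: "q \<ge> 1" and s: "s > q" using r p by (auto simp: q_def s_def divide_strict_right_mono)
  define K where "K = 1 + 2 powr (1 + (s - q)) / (s - q)"
  \<comment> \<open>\<open>Z\<close> turns the truncation level into the index:
    \<open>\<bar>Y \<omega>\<bar>\<close> exceeds \<open>(\<epsilon> * real n) powr (1 / r)\<close>
    exactly when \<open>Z \<omega> > real n\<close>, and \<open>Z \<omega> powr q\<close> is a
    multiple of the integrable \<open>\<bar>Y \<omega>\<bar> powr p\<close>.\<close>
  define Z where "Z = (\<lambda>\<omega>. \<bar>Y \<omega>\<bar> powr r / \<epsilon>)"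
  have Z0: "Z \<omega> \<ge> 0" for \<omega> using e by (simp add: Z_def)
  have [measurable]: "Z \<in> borel_measurable N" unfolding Z_def by measurable
  have Zq: "Z \<omega> powr q = \<bar>Y \<omega>\<bar> powr p / \<epsilon> powr q" for \<omega>
    using e r by (simp add: Z_def powr_divide powr_powr q_def)
  have int_min: "integrable N (\<lambda>\<omega>. min 1 ((Z \<omega> / real n) powr s))" for n
    by (rule finite_measure.integrable_const_bound[OF N, where B = 1]) auto
  have term_le: "real n powr (q - 2) * measure M (?E n)
      \<le> C * (LINT \<omega>|N. real n powr (q - 1) * min 1 ((Z \<omega> / real n) powr s))" if n: "n \<ge> 1" for n
  proof -
    \<comment> \<open>Chosen so that \<open>c\<^sup>2\<close> is the threshold
      \<open>(\<epsilon> * real n) powr (2 / r)\<close> for the sum of squares.\<close>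
    define c where "c = (\<epsilon> * real n) powr (1 / r)"
    have c: "c > 0" using e n by (simp add: c_def)
    have c2: "c\<^sup>2 = (\<epsilon> * real n) powr s"
      using c by (simp add: c_def s_def powr_powr flip: powr_numeral)
    have XI: "k \<in> {1..n} \<Longrightarrow> X k \<in> borel_measurable M" for k by (rule X) simp
    note [measurable] = XI
    have "measure M (?E n) \<le> measure M {\<omega> \<in> space M. (\<Sum>k\<in>{1..n}. (X k \<omega>)\<^sup>2) > c\<^sup>2}"
    \<comment> \<open>Monotonicity asks for measurability of the larger set only, so the event of
      the maximum is handled as it stands.\<close>
    proof (rule M.finite_measure_mono)
      show "?E n \<subseteq> {\<omega> \<in> space M. (\<Sum>k\<in>{1..n}. (X k \<omega>)\<^sup>2) > c\<^sup>2}"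
      proof safe
        fix \<omega>
        assume "(MAX k\<in>{1..n}. real k powr (r / 2) * sphere_mean (P k) k r (\<lambda>j. X j \<omega>)) > \<epsilon> * real n"
        from max_sphere_mean_gt_imp_sum_squares_gt[OF P _ _ n _ this]
        show "(\<Sum>k\<in>{1..n}. (X k \<omega>)\<^sup>2) > c\<^sup>2" using r p e by (simp add: c2 s_def)
      qed
    qed measurable
    also have "\<dots> \<le> (\<Sum>k\<in>{1..n}. LINT \<omega>|M. min ((X k \<omega>)\<^sup>2) (c\<^sup>2)) / c\<^sup>2"
      by (rule prob_sum_squares_gt_le[OF M XI _ c]) auto
    also have "\<dots> \<le> (C * real n) * (LINT \<omega>|N. min ((Y \<omega>)\<^sup>2) (c\<^sup>2)) / c\<^sup>2"
    proof (intro divide_right_mono truncated_square_dominated[OF M XI N Y])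
      fix x :: real assume "x > 0"
      from dom[OF this n] show "(\<Sum>k\<in>{1..n}. measure M {\<omega> \<in> space M. \<bar>X k \<omega>\<bar> > x})
          \<le> (C * real n) * measure N {\<omega> \<in> space N. \<bar>Y \<omega>\<bar> > x}"
        using n by (simp add: field_simps)
    qed (use c C in auto)
    also have "\<dots> = (C * real n) * (LINT \<omega>|N. min ((Y \<omega>)\<^sup>2) (c\<^sup>2) / c\<^sup>2)" by simp
    also have "(\<lambda>\<omega>. min ((Y \<omega>)\<^sup>2) (c\<^sup>2) / c\<^sup>2) = (\<lambda>\<omega>. min 1 ((Z \<omega> / real n) powr s))"
    proof
      fix \<omega>
      have "(\<bar>Y \<omega>\<bar> powr r) powr s = (Y \<omega>)\<^sup>2"
        using r by (simp add: powr_powr s_def powr_numeral)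
      then have "(Z \<omega> / real n) powr s = (Y \<omega>)\<^sup>2 / c\<^sup>2"
        using e by (simp add: Z_def c2 powr_divide powr_mult)
      then show "min ((Y \<omega>)\<^sup>2) (c\<^sup>2) / c\<^sup>2 = min 1 ((Z \<omega> / real n) powr s)"
        using c by (simp add: min_divide_distrib_right min.commute)
    qed
    finally have "real n powr (q - 2) * measure M (?E n)
        \<le> real n powr (q - 2) * ((C * real n) * (LINT \<omega>|N. min 1 ((Z \<omega> / real n) powr s)))"
      by (intro mult_left_mono) auto
    also have "\<dots> = C * ((real n * real n powr (q - 2)) * (LINT \<omega>|N. min 1 ((Z \<omega> / real n) powr s)))"
      by (simp add: mult_ac)
    \<comment> \<open>The factor \<open>n\<close> from undoing the average in \<open>dom\<close>
      raises the exponent from \<open>q - 2\<close> to \<open>q - 1\<close>.\<close>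
    also have "real n * real n powr (q - 2) = real n powr (q - 1)"
      using powr_mult_base[of "real n" "q - 2"] by (simp add: algebra_simps)
    finally show ?thesis by simp
  qed
  \<comment> \<open>A bound uniform over finite \<open>F\<close> suffices because the terms are
    nonnegative. Finiteness of \<open>F\<close> also lets sum and mean be exchanged by linearity,
    after which the sum is bounded pointwise.\<close>
  have "(\<Sum>n\<in>F. real n powr (q - 2) * measure M (?E n)) \<le> C * (LINT \<omega>|N. K * (\<bar>Y \<omega>\<bar> powr p / \<epsilon> powr q))"
    if F: "finite F" "F \<subseteq> {1..}" for F
  proof -
    let ?g = "\<lambda>n \<omega>. real n powr (q - 1) * min 1 ((Z \<omega> / real n) powr s)"
    have int_g: "integrable N (?g n)" for n using int_min by simp
    have "(\<Sum>n\<in>F. real n powr (q - 2) * measure M (?E n)) \<le> (\<Sum>n\<in>F. C * (LINT \<omega>|N. ?g n \<omega>))"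
      using F by (intro sum_mono term_le) auto
    also have "\<dots> = C * (\<Sum>n\<in>F. LINT \<omega>|N. ?g n \<omega>)" by (simp only: sum_distrib_left)
    also have "(\<Sum>n\<in>F. LINT \<omega>|N. ?g n \<omega>) = (LINT \<omega>|N. (\<Sum>n\<in>F. ?g n \<omega>))"
      by (rule Bochner_Integration.integral_sum[symmetric]) (rule int_g)
    also have "C * \<dots> \<le> C * (LINT \<omega>|N. K * (\<bar>Y \<omega>\<bar> powr p / \<epsilon> powr q))"
    proof (intro mult_left_mono integral_mono Bochner_Integration.integrable_sum int_g)
      show "(\<Sum>n\<in>F. ?g n \<omega>) \<le> K * (\<bar>Y \<omega>\<bar> powr p / \<epsilon> powr q)" for \<omega>
        using sum_powr_truncated_le[OF q s Z0 F] by (simp add: K_def flip: Zq)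
    qed (use C int in auto)
    finally show ?thesis .
  qed
  then show ?thesis
    unfolding q_def by (intro nonneg_bdd_above_summable_on bdd_aboveI2) auto
qed

theorem theorem3p3:
  fixes M :: "'a measure" and X :: "nat \<Rightarrow> 'a \<Rightarrow> real"
    and N :: "'b measure" and Y :: "'b \<Rightarrow> real"
    and P :: "nat \<Rightarrow> (nat \<Rightarrow> real) measure"
    and C p :: real
  assumes "prob_space M"
    and "\<And>k. k \<ge> 1 \<Longrightarrow> X k \<in> borel_measurable M"
    and "prob_space N"
    and "Y \<in> borel_measurable N"
    and "\<And>k. k \<ge> 1 \<Longrightarrow> uniform_on_sphere k (P k)"
    and "C > 0"
    and "\<And>x n. x > 0 \<Longrightarrow> n \<ge> 1 \<Longrightarrow>
           1 / real n * (\<Sum>k=1..n. measure M {\<omega> \<in> space M. \<bar>X k \<omega>\<bar> > x})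
             \<le> C * measure N {\<omega> \<in> space N. \<bar>Y \<omega>\<bar> > x}"
    and "1 \<le> p" and "p < 2"
    and "integrable N (\<lambda>\<omega>. \<bar>Y \<omega>\<bar> powr p)"
  shows "(\<forall>r \<epsilon>. 1 \<le> r \<longrightarrow> r < p \<longrightarrow> \<epsilon> > 0 \<longrightarrow>
            (\<lambda>n. real n powr (p / r - 2) *
               measure M {\<omega> \<in> space M.
                 (MAX k\<in>{1..n}. real k powr (r / 2) * sphere_mean (P k) k r (\<lambda>j. X j \<omega>))
                   > \<epsilon> * real n}) summable_on {1..})
       \<and> (integrable N (\<lambda>\<omega>. \<bar>Y \<omega>\<bar> powr p * log_plus \<bar>Y \<omega>\<bar>) \<longrightarrow>
           (\<forall>\<epsilon>>0.
            (\<lambda>n. real n powr (-1) *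
               measure M {\<omega> \<in> space M.
                 (MAX k\<in>{1..n}. real k powr (p / 2) * sphere_mean (P k) k p (\<lambda>j. X j \<omega>))
                   > \<epsilon> * real n}) summable_on {1..}))"
proof -
  interpret M: prob_space M by fact
  interpret N: prob_space N by fact
  note summable = max_sphere_mean_summable[OF M.finite_measure_axioms assms(2)
    N.finite_measure_axioms assms(4,5) _ assms(7) _ _ assms(9,10)]
  show ?thesis
  proof (intro conjI allI impI)
    fix r \<epsilon> :: real
    assume "1 \<le> r" "r < p" "\<epsilon> > 0"
    then show "(\<lambda>n. real n powr (p / r - 2) *
               measure M {\<omega> \<in> space M.
                 (MAX k\<in>{1..n}. real k powr (r / 2) * sphere_mean (P k) k r (\<lambda>j. X j \<omega>))
                   > \<epsilon> * real n}) summable_on {1..}"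
      using assms(6) by (intro summable) auto
  next
    fix \<epsilon> :: real
    assume "\<epsilon> > 0"
    then show "(\<lambda>n. real n powr (-1) *
               measure M {\<omega> \<in> space M.
                 (MAX k\<in>{1..n}. real k powr (p / 2) * sphere_mean (P k) k p (\<lambda>j. X j \<omega>))
                   > \<epsilon> * real n}) summable_on {1..}"
      \<comment> \<open>At \<open>r = p\<close> the weight exponent \<open>p / r - 2\<close> is
        -1.\<close>
      using summable[of p \<epsilon>] assms(6,8) by simp
  qed
qed

end
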